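(* Let $X$ be an infinite-dimensional separable Banach space. Then there exists a continuous linear operator $T:X\to X$ such that $T$ is recurrent and the set $\mathrm{Rec}(T)$ of recurrent vectors for $T$ is not dense-lineable.
   Context: A vector $x\in X$ is recurrent for $T$ if there exists a strictly increasing sequence $(\omega_n)_n$ of positive integers with $\lim_n T^{\omega_n}x=x$; $\mathrm{Rec}(T)$ is the set of recurrent vectors. $T$ is recurrent if $\mathrm{Rec}(T)$ is dense in $X$. A subset $A\subset X$ is dense-lineable if $A\cup\{0\}$ contains a dense vector subspace of $X$. *)

theory Defs
  imports "HOL-Analysis.Analysis"
begin

text \<open>
  The class \<^class>\<open>banach\<close> consists of real Banach spaces. A complex Banach space is a type of this
  class together with a scalar multiplication that satisfies the following locale for the scalar
  field \<^typ>\<open>complex\<close>; the real multiplication of the class is then its restriction to the reals.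
\<close>

locale normed_space_over = vector_space smul
  for smul :: "'k::real_normed_field \<Rightarrow> 'a::real_normed_vector \<Rightarrow> 'a" +
  assumes scale_of_real: "smul (of_real r) x = r *\<^sub>R x"
    and norm_scale: "norm (smul c x) = norm c * norm x"

definition infinite_dimensional :: "('k::field \<Rightarrow> 'a::ab_group_add \<Rightarrow> 'a) \<Rightarrow> bool" where
  "infinite_dimensional smul \<longleftrightarrow> (\<nexists>B. finite B \<and> module.span smul B = UNIV)"

definition recurrent_vector :: "('a::topological_space \<Rightarrow> 'a) \<Rightarrow> 'a \<Rightarrow> bool" where
  "recurrent_vector T x \<longleftrightarrow>
    (\<exists>\<omega>::nat \<Rightarrow> nat. strict_mono \<omega> \<and> (\<forall>n. 0 < \<omega> n) \<and> (\<lambda>n. (T ^^ \<omega> n) x) \<longlonglongrightarrow> x)"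

definition Rec :: "('a::topological_space \<Rightarrow> 'a) \<Rightarrow> 'a set" where
  "Rec T = {x. recurrent_vector T x}"

definition recurrent :: "('a::topological_space \<Rightarrow> 'a) \<Rightarrow> bool" where
  "recurrent T \<longleftrightarrow> closure (Rec T) = UNIV"

definition dense_lineable ::
    "('k::field \<Rightarrow> 'a::{ab_group_add, topological_space} \<Rightarrow> 'a) \<Rightarrow> 'a set \<Rightarrow> bool" where
  "dense_lineable smul A \<longleftrightarrow>
    (\<exists>V. module.subspace smul V \<and> closure V = UNIV \<and> V \<subseteq> A \<union> {0})"

lemma normed_space_over_scaleR:
  "normed_space_over ((*\<^sub>R) :: real \<Rightarrow> 'a::real_normed_vector \<Rightarrow> 'a)"
  by unfold_locales (simp_all add: algebra_simps)

lemma infinite_dimensional_scaleR_iff: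
  "infinite_dimensional ((*\<^sub>R) :: real \<Rightarrow> 'a::real_normed_vector \<Rightarrow> 'a) \<longleftrightarrow>
    (\<nexists>B :: 'a set. finite B \<and> span B = UNIV)"
  by (simp add: infinite_dimensional_def span_raw_def)

lemma dense_lineable_scaleR_iff:
  "dense_lineable (*\<^sub>R) (A :: 'a::real_normed_vector set) \<longleftrightarrow>
    (\<exists>V. subspace V \<and> closure V = UNIV \<and> V \<subseteq> A \<union> {0})"
  by (simp add: dense_lineable_def subspace_raw_def)

end

theory Submission
  imports Defs
begin

text \<open>
  Choose vectors \<open>e n\<close> and bounded functionals \<open>f n\<close> that are biorthogonal, such that the vectors killed
  by all but finitely many \<open>f n\<close> are dense. The operator \<open>T\<close> is a nuclear perturbation of the identity
  that fixes the coordinates \<open>f 0\<close> and \<open>f 1\<close> and rotates the plane of \<open>e (2 * k + 2)\<close> and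
  \<open>e (2 * k + 3)\<close> with period \<open>period (k + 1)\<close> about the centre \<open>ratio (k + 1) * (b k * f 0 x - f 1 x)\<close>. Here
  \<open>ratio (k + 1) = period (k + 1) / period k\<close> grows fast and \<open>b\<close> takes each value of a dense set of scalars infinitely often.

  At time \<open>period j\<close> the planes \<open>k < j\<close> are back at their start and the planes \<open>k > j\<close> have hardly moved,
  while the plane \<open>j\<close> has moved by about the modulus of \<open>b j * f 0 x - f 1 x\<close>. This vanishes for
  infinitely many \<open>j\<close> on a dense set of \<open>x\<close>, which gives recurrence. If \<open>f 0 x = 0\<close> and \<open>f 1 x \<noteq> 0\<close>,
  then the orbit of \<open>x\<close> stays away from \<open>x\<close> after some time, since every large \<open>n\<close> lies between \<open>period k / 2\<close> and
  \<open>period (k + 1) / 2\<close> for some \<open>k\<close>, when the plane \<open>k\<close> is displaced by at least a multiple of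
  \<open>f 1 x\<close>. Every dense subspace contains such an \<open>x\<close>.
\<close>

section \<open>Bounded functionals separate points\<close>

definition sublinear :: "('a::real_vector \<Rightarrow> real) \<Rightarrow> bool" where
  "sublinear p \<longleftrightarrow> (\<forall>x y. p (x + y) \<le> p x + p y) \<and> (\<forall>t>0. \<forall>x. p (t *\<^sub>R x) \<le> t * p x)"

lemma sublinear_add: "sublinear p \<Longrightarrow> p (x + y) \<le> p x + p y"
  by (simp add: sublinear_def)

lemma sublinear_scale_le: "sublinear p \<Longrightarrow> 0 < t \<Longrightarrow> p (t *\<^sub>R x) \<le> t * p x"
  by (simp add: sublinear_def)

lemma sublinear_scale:
  assumes "sublinear p" "0 < t"
  shows "p (t *\<^sub>R x) = t * p x"
proof (rule antisym)
  have "p (inverse t *\<^sub>R (t *\<^sub>R x)) \<le> inverse t * p (t *\<^sub>R x)"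
    using assms by (intro sublinear_scale_le) auto
  then show "t * p x \<le> p (t *\<^sub>R x)"
    using assms(2) by (simp add: field_simps)
qed (use assms in \<open>rule sublinear_scale_le\<close>)

lemma sublinear_zero: "sublinear p \<Longrightarrow> p 0 = 0"
  using sublinear_scale[of p 2 0] by simp

lemma sublinear_ge_uminus: "sublinear p \<Longrightarrow> - p (- x) \<le> p x"
  using sublinear_add[of p x "- x"] sublinear_zero[of p] by simp

text \<open>The infimum over \<open>t \<ge> 0\<close> of
  \<open>p (x + t *\<^sub>R y) - t * p y\<close> works: t = 0 gives \<open>p' \<le> p\<close>, t = 1
  gives the last bound, and \<open>- p (- x)\<close> bounds it from below.\<close>

lemma sublinear_refine:
  assumes p: "sublinear p"
  shows "\<exists>p'. sublinear p' \<and> p' \<le> p \<and> (\<forall>x. p' x \<le> p (x + y) - p y)"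
proof -
  define g where "g x t = p (x + t *\<^sub>R y) - t * p y" for x t
  define p' where "p' x = (INF t\<in>{0..}. g x t)" for x
  have g_ge: "- p (- x) \<le> g x t" if "0 \<le> t" for x t
  proof -
    have "p (t *\<^sub>R y) = t * p y"
      using that sublinear_scale[OF p, of t y] sublinear_zero[OF p] by (cases "t = 0") auto
    then show ?thesis
      using sublinear_add[OF p, of "- x" "x + t *\<^sub>R y"] by (simp add: g_def)
  qed
  have p'_le: "p' x \<le> g x t" if "0 \<le> t" for x t
    unfolding p'_def using that g_ge by (intro cINF_lower bdd_belowI2[where m = "- p (- x)"]) auto
  have p'_ge: "c \<le> p' x" if "\<And>t. 0 \<le> t \<Longrightarrow> c \<le> g x t" for c x
    unfolding p'_def using that by (intro cINF_greatest) auto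
  have g_add: "g (x + z) (s + t) \<le> g x s + g z t" for x z s t
    using sublinear_add[OF p, of "x + s *\<^sub>R y" "z + t *\<^sub>R y"]
    by (simp add: g_def algebra_simps)
  have "p' (x + z) \<le> p' x + p' z" for x z
  proof -
    have "p' (x + z) - g x s \<le> g z t" if "0 \<le> s" "0 \<le> t" for s t
      using p'_le[of "s + t" "x + z"] g_add[of x z s t] that by simp
    then have "p' (x + z) - g x s \<le> p' z" if "0 \<le> s" for s
      using that by (intro p'_ge) auto
    then have "p' (x + z) - p' z \<le> g x s" if "0 \<le> s" for s
      using that by (smt (verit))
    then have "p' (x + z) - p' z \<le> p' x"
      by (rule p'_ge)
    then show ?thesis by simp
  qed
  moreover have "p' (t *\<^sub>R x) \<le> t * p' x" if "0 < t" for t x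
  proof -
    have "p' (t *\<^sub>R x) / t \<le> g x s" if "0 \<le> s" for s
    proof -
      have "g (t *\<^sub>R x) (t * s) = t * g x s"
        using sublinear_scale[OF p \<open>0 < t\<close>, of "x + s *\<^sub>R y"]
        by (simp add: g_def algebra_simps)
      then show ?thesis
        using p'_le[of "t * s" "t *\<^sub>R x"] that \<open>0 < t\<close> by (simp add: field_simps)
    qed
    then have "p' (t *\<^sub>R x) / t \<le> p' x"
      by (rule p'_ge)
    then show ?thesis
      using that by (simp add: field_simps)
  qed
  ultimately have "sublinear p'"
    by (simp add: sublinear_def)
  moreover have "p' \<le> p"
    using p'_le[of 0] by (auto simp: le_fun_def g_def)
  moreover have "p' x \<le> p (x + y) - p y" for x
    using p'_le[of 1 x] by (simp add: g_def)
  ultimately show ?thesis by blast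
qed

text \<open>Supplies the lower bounds for Zorn's lemma. Subadditivity survives because two members
  of a chain can be replaced by the smaller one; the common majorant \<open>p\<close> keeps the
  infimum finite.\<close>

lemma sublinear_INF:
  assumes "C \<noteq> {}" and sub: "\<And>q. q \<in> C \<Longrightarrow> sublinear q \<and> q \<le> p"
    and chain: "\<And>q q'. q \<in> C \<Longrightarrow> q' \<in> C \<Longrightarrow> q \<le> q' \<or> q' \<le> q"
  shows "sublinear (\<lambda>x. INF q\<in>C. q x)" and "q \<in> C \<Longrightarrow> (\<lambda>x. INF q\<in>C. q x) \<le> q"
proof -
  define p' where "p' x = (INF q\<in>C. q x)" for x
  have "- p (- x) \<le> q x" if "q \<in> C" for q x
    using sub[OF that] sublinear_ge_uminus[of q x] by (smt (verit) le_funD)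
  then have p'_le: "p' x \<le> q x" if "q \<in> C" for q x
    unfolding p'_def using that by (intro cINF_lower bdd_belowI2[where m = "- p (- x)"]) auto
  have p'_ge: "c \<le> p' x" if "\<And>q. q \<in> C \<Longrightarrow> c \<le> q x" for c x
    unfolding p'_def using that \<open>C \<noteq> {}\<close> by (intro cINF_greatest) auto
  have *: "p' (x + y) \<le> q x + q' y" if qq': "q \<in> C" "q' \<in> C" for q q' x y
  proof -
    obtain r where r: "r \<in> C" "r \<le> q" "r \<le> q'"
      using chain[OF qq'] qq' by blast
    then have "p' (x + y) \<le> r x + r y"
      using p'_le[of r "x + y"] sublinear_add[of r x y] sub by fastforce
    also have "\<dots> \<le> q x + q' y"
      using r by (intro add_mono) (auto simp: le_fun_def)
    finally show ?thesis .
  qed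
  have "p' (x + y) \<le> p' x + p' y" for x y
  proof -
    have "p' (x + y) - q x \<le> p' y" if "q \<in> C" for q
      using *[OF that, of _ x y] by (intro p'_ge) (auto simp: algebra_simps)
    then have "p' (x + y) - p' y \<le> p' x"
      by (intro p'_ge) (auto simp: algebra_simps)
    then show ?thesis by simp
  qed
  moreover have "p' (t *\<^sub>R x) \<le> t * p' x" if "0 < t" for t x
  proof -
    have "p' (t *\<^sub>R x) / t \<le> q x" if "q \<in> C" for q
      using p'_le[OF that, of "t *\<^sub>R x"] sublinear_scale[of q t x] sub[OF that] \<open>0 < t\<close>
      by (simp add: field_simps)
    then have "p' (t *\<^sub>R x) / t \<le> p' x"
      by (rule p'_ge)
    then show ?thesis
      using that by (simp add: field_simps)
  qed
  ultimately show "sublinear (\<lambda>x. INF q\<in>C. q x)"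
    by (simp add: sublinear_def flip: p'_def)
  show "(\<lambda>x. INF q\<in>C. q x) \<le> q" if "q \<in> C"
    using p'_le[OF that] by (simp add: le_fun_def flip: p'_def)
qed

text \<open>By \<open>sublinear_refine\<close>, a minimal sublinear functional is superadditive, hence linear.\<close>

lemma exists_linear_le_sublinear:
  assumes p: "sublinear (p :: 'a::real_vector \<Rightarrow> real)"
  shows "\<exists>u. linear u \<and> u \<le> p"
proof -
  define A where "A = {q. sublinear q \<and> q \<le> p}"
  have "\<exists>u\<in>A. \<forall>q\<in>A. q \<le> u \<longrightarrow> q = u"
  \<comment> \<open>The order is reversed because a minimal element is wanted.\<close>
  proof (rule predicate_Zorn[where P = "\<lambda>q q'. q' \<le> q"])
    show "partial_order_on A (relation_of (\<lambda>q q'. q' \<le> q) A)"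
      by (rule partial_order_on_relation_ofI) auto
    fix C assume "C \<in> Chains (relation_of (\<lambda>q q'. q' \<le> q) A)"
    then have C: "\<And>q q'. q \<in> C \<Longrightarrow> q' \<in> C \<Longrightarrow> (q \<in> A \<and> q' \<in> A) \<and> (q \<le> q' \<or> q' \<le> q)"
      by (fastforce simp: Chains_def relation_of_def)
    show "\<exists>u\<in>A. \<forall>q\<in>C. u \<le> q"
    proof (cases "C = {}")
      case True
      with p show ?thesis by (auto simp: A_def)
    next
      case False
      note inf = sublinear_INF[of C p]
      have "sublinear (\<lambda>x. INF q\<in>C. q x)" "\<forall>r\<in>C. (\<lambda>x. INF q\<in>C. q x) \<le> r"
        using False C by (auto simp: A_def intro!: inf)
      moreover obtain r where "r \<in> C"
        using False by blast
      ultimately show ?thesis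
        using C unfolding A_def by (intro bexI[of _ "\<lambda>x. INF q\<in>C. q x"]) (auto intro: order_trans)
    qed
  qed
  then obtain u where u: "sublinear u" "u \<le> p"
    and min: "\<And>q. sublinear q \<Longrightarrow> q \<le> u \<Longrightarrow> q = u"
    by (auto simp: A_def intro: order_trans)
  have add: "u (x + y) = u x + u y" for x y
  proof (rule antisym)
    obtain q where "sublinear q" "q \<le> u" and q: "\<forall>x. q x \<le> u (x + y) - u y"
      using sublinear_refine[OF u(1)] by blast
    then have "q = u" using min by blast
    with q show "u x + u y \<le> u (x + y)"
      by (metis le_diff_eq)
  qed (rule sublinear_add[OF u(1)])
  have "u (t *\<^sub>R x) = t * u x" for t x
  proof -
    have neg: "u (- z) = - u z" for z
      using add[of z "- z"] sublinear_zero[OF u(1)] by simp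
    consider "t = 0" | "0 < t" | "0 < - t" by linarith
    then show ?thesis
      using sublinear_scale[OF u(1)] sublinear_zero[OF u(1)] sublinear_scale[OF u(1), of "- t" x] neg
      by cases auto
  qed
  with add have "linear u"
    by (intro linearI) auto
  with u show ?thesis by blast
qed

text \<open>Refining the norm at \<open>x\<close> gives \<open>p\<close> with
  \<open>p (- x) \<le> - norm x\<close>; a linear \<open>u\<close> below \<open>p\<close> then
  satisfies \<open>norm x \<le> u x\<close>.\<close>

lemma exists_bounded_linear_nonzero:
  assumes "x \<noteq> (0 :: 'a::real_normed_vector)"
  shows "\<exists>u :: 'a \<Rightarrow> real. bounded_linear u \<and> u x \<noteq> 0"
proof -
  have "sublinear (norm :: 'a \<Rightarrow> real)"
    by (auto simp: sublinear_def norm_triangle_ineq)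
  then obtain p where p: "sublinear p" "p \<le> norm" "\<forall>z. p z \<le> norm (z + x) - norm x"
    using sublinear_refine by blast
  obtain u where u: "linear u" "u \<le> p"
    using exists_linear_le_sublinear[OF p(1)] by blast
  have le: "u z \<le> norm z" for z
    using u(2) p(2) by (meson le_funD order_trans)
  have "\<bar>u z\<bar> \<le> norm z" for z
    using le[of z] le[of "- z"] linear_neg[OF u(1), of z] by (auto simp: abs_le_iff)
  then have "bounded_linear u"
    using u(1) by (intro bounded_linear.intro bounded_linear_axioms.intro exI[of _ 1]) auto
  moreover have "u (- x) \<le> - norm x"
    using le_funD[OF u(2), of "- x"] p(3)[rule_format, of "- x"] by simp
  then have "u x \<noteq> 0"
    using linear_neg[OF u(1), of x] assms by auto
  ultimately show ?thesis by blast
qed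

section \<open>Biorthogonal sequences\<close>

context normed_space_over
begin

lemma bounded_bilinear_smul: "bounded_bilinear smul"
proof
  show "smul (r *\<^sub>R a) x = r *\<^sub>R smul a x" for r a x
    by (simp add: scaleR_conv_of_real flip: scale_of_real)
  show "smul a (r *\<^sub>R x) = r *\<^sub>R smul a x" for r a x
    by (simp add: mult.commute flip: scale_of_real)
  show "\<exists>K. \<forall>a x. norm (smul a x) \<le> norm a * norm x * K"
    by (intro exI[of _ 1]) (simp add: norm_scale)
qed (simp_all add: scale_left_distrib scale_right_distrib)

definition bounded_functional :: "('a \<Rightarrow> 'k) \<Rightarrow> bool" where
  "bounded_functional h \<longleftrightarrow> bounded_linear h \<and> (\<forall>a x. h (smul a x) = a * h x)"

text \<open>A Gram-Schmidt process along \<open>x\<close>: after step n the vector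
  \<open>x n\<close> lies in the span of \<open>e 0, ..., e n\<close>, so later functionals vanish
  on it. Infinite dimension lets the process continue forever.\<close>

lemma exists_biorthogonal_sequence:
  fixes x :: "nat \<Rightarrow> 'a"
  assumes inf: "infinite_dimensional smul"
    and separated: "\<And>v. v \<noteq> 0 \<Longrightarrow> \<exists>h. bounded_functional h \<and> h v \<noteq> 0"
  shows "\<exists>e f. (\<forall>n. bounded_functional (f n)) \<and> (\<forall>n z. norm (f n z) \<le> norm z) \<and>
    (\<forall>i j. f i (e j) = (if i = j then 1 else 0)) \<and> (\<forall>n k. n < k \<longrightarrow> f k (x n) = 0)"
proof -
  \<comment> \<open>\<open>P s n r\<close> says that \<open>r\<close> may serve as the n-th pair of
    vector and functional after \<open>s 0, ..., s (n - 1)\<close>; the last conjunct puts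
    \<open>x n\<close> in the span of the first n + 1 vectors.\<close>
  define P :: "(nat \<Rightarrow> 'a \<times> ('a \<Rightarrow> 'k)) \<Rightarrow> nat \<Rightarrow> 'a \<times> ('a \<Rightarrow> 'k) \<Rightarrow> bool" where
    "P s n r \<longleftrightarrow> bounded_functional (snd r) \<and> (\<forall>z. norm (snd r z) \<le> norm z) \<and> snd r (fst r) = 1 \<and>
      (\<forall>k<n. snd (s k) (fst r) = 0 \<and> snd r (fst (s k)) = 0) \<and>
      x n = (\<Sum>k<n. smul (snd (s k) (x n)) (fst (s k))) + smul (snd r (x n)) (fst r)" for s n r
  have "\<exists>s. \<forall>n. P s n (s n)"
  proof (rule dependent_wellorder_choice)
    show "P s n r = P s' n r" if "\<And>k. k < n \<Longrightarrow> s k = s' k" for r s s' n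
    proof -
      have "(\<Sum>k<n. smul (snd (s k) (x n)) (fst (s k))) = (\<Sum>k<n. smul (snd (s' k) (x n)) (fst (s' k)))"
        using that by (intro sum.cong) auto
      with that show ?thesis by (simp add: P_def)
    qed
  next
    fix n :: nat and s :: "nat \<Rightarrow> 'a \<times> ('a \<Rightarrow> 'k)"
    assume s: "\<And>k. k < n \<Longrightarrow> P s k (s k)"
    define e f where "e k = fst (s k)" and "f k = snd (s k)" for k
    have f: "bounded_functional (f k)" "f k (e k) = 1" if "k < n" for k
      using s[OF that] by (auto simp: P_def e_def f_def)
    have bl: "bounded_linear (f k)" if "k < n" for k
      using f[OF that] by (simp add: bounded_functional_def)
    have bio: "f i (e j) = (if i = j then 1 else 0)" if "i < n" "j < n" for i j
    proof (cases i j rule: linorder_cases)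
      case less
      then show ?thesis using s[OF that(2)] by (auto simp: P_def e_def f_def)
    next
      case equal
      then show ?thesis using f that by auto
    next
      case greater
      then show ?thesis using s[OF that(1)] by (auto simp: P_def e_def f_def)
    qed
    \<comment> \<open>\<open>Q\<close> projects onto the common kernel of
      \<open>f 0, ..., f (n - 1)\<close> along the span of
      \<open>e 0, ..., e (n - 1)\<close>.\<close>
    define Q where "Q z = z - (\<Sum>k<n. smul (f k z) (e k))" for z
    interpret smul: bounded_bilinear smul by (rule bounded_bilinear_smul)
    have Q_bl: "bounded_linear Q"
      unfolding Q_def using bl
      by (intro bounded_linear_sub bounded_linear_ident bounded_linear_sum
          smul.bounded_linear_left[THEN bounded_linear_compose]) auto
    have Q_smul: "Q (smul a z) = smul a (Q z)" for a z
      using f by (simp add: Q_def scale_right_diff_distrib scale_sum_right bounded_functional_def)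
    have Q_e: "Q (e j) = 0" if "j < n" for j
    proof -
      have "(\<Sum>k<n. smul (f k (e j)) (e k)) = (\<Sum>k<n. if k = j then e j else 0)"
        using that by (intro sum.cong) (auto simp: bio)
      with that show ?thesis by (simp add: Q_def)
    qed
    have f_Q: "f j (Q z) = 0" if "j < n" for j z
    proof -
      have "f j (Q z) = f j z - (\<Sum>k<n. f k z * f j (e k))"
        using f[OF that] bl[OF that]
        by (simp add: Q_def bounded_functional_def linear_diff linear_sum bounded_linear.linear)
      also have "(\<Sum>k<n. f k z * f j (e k)) = (\<Sum>k<n. if k = j then f j z else 0)"
        using that by (intro sum.cong) (auto simp: bio)
      finally show ?thesis using that by simp
    qed
    have Q_Q: "Q (Q z) = Q z" for z
      using f_Q by (simp add: Q_def[of "Q z"])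
    have "\<exists>y. Q y \<noteq> 0"
    proof (rule ccontr)
      assume "\<nexists>y. Q y \<noteq> 0"
      then have eq: "z = (\<Sum>k<n. smul (f k z) (e k))" for z
        by (simp add: Q_def)
      have "z \<in> module.span smul (e ` {..<n})" for z
        by (subst eq[of z], rule span_sum, rule span_scale, rule span_base) simp
      then have "module.span smul (e ` {..<n}) = UNIV" by blast
      with inf show False
        unfolding infinite_dimensional_def by blast
    qed
    \<comment> \<open>Take \<open>x n\<close> itself if it is outside the span so far; otherwise any
      vector outside the span will do.\<close>
    then obtain y where y: "Q y \<noteq> 0" "Q (x n) \<noteq> 0 \<Longrightarrow> y = x n"
      by metis
    obtain h where h: "bounded_functional h" "h (Q y) \<noteq> 0"
      using separated[OF y(1)] by blast
    define g where "g z = h (Q z)" for z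
    have g_bl: "bounded_linear g"
      unfolding g_def using h Q_bl by (auto simp: bounded_functional_def intro: bounded_linear_compose)
    obtain C where C: "0 < C" "\<And>z. norm (g z) \<le> norm z * C"
      using bounded_linear.pos_bounded[OF g_bl] by blast
    \<comment> \<open>Dividing by \<open>C\<close> bounds the functional by the norm; the factor in
      \<open>e'\<close> restores \<open>f' e' = 1\<close>.\<close>
    define f' where "f' z = g z / of_real C" for z
    define e' where "e' = smul (of_real C / g y) (Q y)"
    have g_smul: "g (smul a z) = a * g z" for a z
      using h by (simp add: g_def Q_smul bounded_functional_def)
    have gy: "g y \<noteq> 0" using h by (simp add: g_def)
    have f'_functional: "bounded_functional f'"
      unfolding bounded_functional_def f'_def
      using g_bl by (auto simp: g_smul intro: bounded_linear_compose[OF bounded_linear_divide])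
    have Q0: "Q 0 = 0" and h0: "h 0 = 0"
      using Q_bl h by (auto simp: bounded_functional_def linear_0 bounded_linear.linear)
    have "norm (f' z) \<le> norm z" for z
      using C by (simp add: f'_def norm_divide field_simps)
    moreover have "f' e' = 1"
      using C gy by (simp add: f'_def e'_def g_smul) (simp add: g_def Q_Q)
    moreover have "f k e' = 0" "f' (e k) = 0" if "k < n" for k
      using f[OF that] f_Q[OF that] Q_e[OF that] h0
      by (simp_all add: e'_def f'_def g_def bounded_functional_def)
    moreover have "Q (x n) = smul (f' (x n)) e'"
    proof (cases "Q (x n) = 0")
      case True
      then show ?thesis by (simp add: f'_def g_def h0)
    next
      case False
      then show ?thesis using y(2) C gy by (simp add: f'_def e'_def)
    qed
    then have "x n = (\<Sum>k<n. smul (f k (x n)) (e k)) + smul (f' (x n)) e'"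
      by (simp add: Q_def algebra_simps)
    ultimately have "P s n (e', f')"
      using f'_functional by (simp add: P_def e_def f_def)
    then show "\<exists>r. P s n r" ..
  qed
  then obtain s where s: "\<And>n. P s n (s n)" by blast
  define e f where "e k = fst (s k)" and "f k = snd (s k)" for k
  have f: "bounded_functional (f k)" "f k (e k) = 1" "norm (f k z) \<le> norm z" for k z
    using s[of k] by (auto simp: P_def e_def f_def)
  have bio: "f i (e j) = (if i = j then 1 else 0)" for i j
    using s[of i] s[of j] by (cases i j rule: linorder_cases) (auto simp: P_def e_def f_def)
  have "f k (x n) = 0" if "n < k" for n k
  proof -
    have "x n = (\<Sum>i<n. smul (f i (x n)) (e i)) + smul (f n (x n)) (e n)"
      using s[of n] by (simp add: P_def e_def f_def)
    then have "f k (x n) = f k (\<Sum>i<Suc n. smul (f i (x n)) (e i))"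
      by simp
    also have "\<dots> = (\<Sum>i<Suc n. f i (x n) * f k (e i))"
      using f(1)[of k] by (simp add: bounded_functional_def linear_sum linear_add bounded_linear.linear)
    also have "\<dots> = 0"
      using that by (intro sum.neutral) (auto simp: bio)
    finally show ?thesis .
  qed
  with f bio show ?thesis by blast
qed

end

section \<open>The operator\<close>

lemma abs_cos_minus_one_le: "\<bar>cos t - 1\<bar> \<le> \<bar>t :: real\<bar>"
proof -
  have "cos t = 1 - 2 * sin (t / 2) ^ 2"
    using cos_double_sin[of "t / 2"] by simp
  then have "\<bar>cos t - 1\<bar> = 2 * (\<bar>sin (t / 2)\<bar> * \<bar>sin (t / 2)\<bar>)"
    by (simp add: power2_eq_square)
  also have "\<dots> \<le> 2 * (1 * \<bar>t / 2\<bar>)"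
    by (intro mult_left_mono mult_mono abs_sin_x_le_abs_x) auto
  finally show ?thesis by simp
qed

text \<open>A weak Jordan inequality: \<open>t ^ 2 \<le> 4\<close> on this range, so the Taylor
  bound \<open>t - t ^ 3 / 6\<close> is at least \<open>t / 3\<close>.\<close>

lemma sin_ge_third:
  assumes "0 \<le> t" "t \<le> pi / 2"
  shows "t / 3 \<le> sin t"
proof -
  have "\<bar>sin t - (\<Sum>m<3. sin_coeff m * t ^ m)\<bar> \<le> inverse (fact 3) * \<bar>t\<bar> ^ 3"
    by (rule Maclaurin_sin_bound)
  then have "\<bar>sin t - t\<bar> \<le> t ^ 3 / 6"
    using assms by (simp add: eval_nat_numeral sin_coeff_def)
  then have "t - sin t \<le> t ^ 3 / 6"
    by linarith
  moreover have "t ^ 2 \<le> 2 ^ 2"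
    using assms pi_less_4 by (intro power_mono) auto
  then have "t * t ^ 2 \<le> t * 4"
    using assms by (intro mult_left_mono) auto
  ultimately show ?thesis
    by (simp add: power3_eq_cube power2_eq_square)
qed

locale biorthogonal_sequence = normed_space_over smul
  for smul :: "'k::real_normed_field \<Rightarrow> 'a::banach \<Rightarrow> 'a" +
  fixes e :: "nat \<Rightarrow> 'a" and f :: "nat \<Rightarrow> 'a \<Rightarrow> 'k" and b :: "nat \<Rightarrow> 'k"
  assumes functional: "bounded_functional (f n)"
    and norm_functional_le: "norm (f n x) \<le> norm x"
    and biorthogonal: "f i (e j) = (if i = j then 1 else 0)"
begin

lemma bounded_linear_f: "bounded_linear (f n)"
  using functional by (simp add: bounded_functional_def)

lemma f_smul [simp]: "f n (smul a x) = a * f n x"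
  using functional by (simp add: bounded_functional_def)

lemma f_add [simp]: "f n (x + y) = f n x + f n y"
  by (simp add: bounded_linear_f bounded_linear.linear linear_add)

lemma f_diff [simp]: "f n (x - y) = f n x - f n y"
  by (simp add: bounded_linear_f bounded_linear.linear linear_diff)

text \<open>Size of block \<open>k\<close>: the first factor bounds
  \<open>b k * f 0 x - f 1 x\<close> relative to \<open>norm x\<close>, the second the vectors of
  the plane.\<close>

definition weight :: "nat \<Rightarrow> real" where
  "weight k = (1 + norm (b k)) * (norm (e (2 * k + 2)) + norm (e (2 * k + 3)))"

text \<open>Chosen so that \<open>weight k / ratio k\<close> is at most \<open>(1 / 4) ^ k\<close>;
  since \<open>ratio k\<close> divides \<open>period k\<close>, this makes the blocks
  summable.\<close>

definition ratio :: "nat \<Rightarrow> nat" where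
  "ratio k = nat \<lceil>4 ^ k * (1 + weight k)\<rceil>"

definition period :: "nat \<Rightarrow> nat" where
  "period k = (\<Prod>i\<le>k. ratio i)"

definition ang :: "nat \<Rightarrow> real" where
  "ang k = 2 * pi / real (period (Suc k))"

text \<open>
  In the plane spanned by \<open>e (2 * k + 2)\<close> and \<open>e (2 * k + 3)\<close>, the iterate \<open>T n\<close> below rotates by the
  angle \<open>n * ang k\<close> about the point whose coordinates are \<open>ratio (Suc k) * (b k * f 0 x - f 1 x)\<close>
  and \<open>0\<close>; the functions \<open>coord1\<close>, \<open>coord2\<close> are the coordinates relative to this centre.
\<close>

definition coord1 :: "nat \<Rightarrow> 'a \<Rightarrow> 'k" where
  "coord1 k x = f (2 * k + 2) x - of_nat (ratio (Suc k)) * (b k * f 0 x - f 1 x)"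

definition coord2 :: "nat \<Rightarrow> 'a \<Rightarrow> 'k" where
  "coord2 k x = f (2 * k + 3) x"

definition shift1 :: "nat \<Rightarrow> nat \<Rightarrow> 'a \<Rightarrow> 'k" where
  "shift1 n k x = of_real (cos (real n * ang k) - 1) * coord1 k x - of_real (sin (real n * ang k)) * coord2 k x"

definition shift2 :: "nat \<Rightarrow> nat \<Rightarrow> 'a \<Rightarrow> 'k" where
  "shift2 n k x = of_real (sin (real n * ang k)) * coord1 k x + of_real (cos (real n * ang k) - 1) * coord2 k x"

definition block :: "nat \<Rightarrow> nat \<Rightarrow> 'a \<Rightarrow> 'a" where
  "block n k x = smul (shift1 n k x) (e (2 * k + 2)) + smul (shift2 n k x) (e (2 * k + 3))"

text \<open>A closed form for the powers: the operator itself is \<open>T 1\<close>, and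
  \<open>T_funpow\<close> identifies \<open>T n\<close> with its n-th iterate.\<close>

definition T :: "nat \<Rightarrow> 'a \<Rightarrow> 'a" where
  "T n x = x + (\<Sum>k. block n k x)"

section \<open>Growth of the ratios and periods\<close>

lemma weight_nonneg: "0 \<le> weight k"
  by (simp add: weight_def)

lemma ratio_ge: "4 ^ k * (1 + weight k) \<le> real (ratio k)"
  unfolding ratio_def by (rule real_nat_ceiling_ge)

lemma ratio_ge_power: "4 ^ k \<le> real (ratio k)"
proof -
  have "4 ^ k * 1 \<le> 4 ^ k * (1 + weight k)"
    using weight_nonneg by (intro mult_left_mono) auto
  with ratio_ge[of k] show ?thesis by linarith
qed

lemma ratio_pos: "0 < ratio k"
  using ratio_ge_power[of k] by (metis of_nat_0_less_iff less_le_trans zero_less_numeral zero_less_power)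

lemma weight_le_ratio: "weight k \<le> (1 / 4) ^ k * real (ratio k)"
proof -
  have "4 ^ k * weight k \<le> real (ratio k)"
    using ratio_ge[of k] by (simp add: algebra_simps) (smt (verit) zero_le_power)
  then show ?thesis
    by (simp add: field_simps power_divide)
qed

lemma period_Suc: "period (Suc k) = period k * ratio (Suc k)"
  by (simp add: period_def mult.commute)

lemma period_pos: "0 < period k"
  using ratio_pos by (simp add: period_def prod_pos)

lemma period_dvd: "j \<le> k \<Longrightarrow> period j dvd period k"
  unfolding period_def by (intro prod_dvd_prod_subset) auto

text \<open>The factor \<open>ratio k\<close> that \<open>period k\<close> has beyond
  \<open>period j\<close> absorbs \<open>weight k\<close> in
  \<open>norm_block_period_le\<close>.\<close>

lemma period_mult_ratio_le:
  assumes "j < k"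
  shows "period j * ratio k \<le> period k"
proof -
  obtain i where i: "k = Suc i" "j \<le> i"
    using assms by (metis Suc_diff_1 less_Suc_eq_le not_less_zero neq0_conv)
  then have "period j \<le> period i"
    using period_dvd period_pos by (intro dvd_imp_le) auto
  with i show ?thesis by (simp add: period_Suc)
qed

lemma ratio_le_period: "ratio k \<le> period k"
proof -
  have "ratio k dvd period k"
    unfolding period_def by (intro dvd_prodI) auto
  then show ?thesis
    using period_pos by (intro dvd_imp_le) auto
qed

lemma strict_mono_period: "strict_mono period"
proof (rule strict_mono_Suc_iff[THEN iffD2], rule allI)
  fix k
  have "(4::real) \<le> 4 ^ Suc k"
    by simp
  then have "1 < real (ratio (Suc k))"
    using ratio_ge_power[of "Suc k"] by linarith
  then have "1 < ratio (Suc k)"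
    by simp
  then show "period k < period (Suc k)"
    using period_pos[of k] by (simp add: period_Suc)
qed

section \<open>Bounds on the blocks\<close>

lemma norm_coord1_coord2_le:
  "norm (coord1 k x) + norm (coord2 k x) \<le> 3 * real (ratio (Suc k)) * (1 + norm (b k)) * norm x"
proof -
  have *: "norm (b k * f 0 x - f 1 x) \<le> (1 + norm (b k)) * norm x"
  proof -
    have "norm (b k * f 0 x - f 1 x) \<le> norm (b k) * norm (f 0 x) + norm (f 1 x)"
      by (metis norm_mult norm_triangle_ineq4)
    also have "\<dots> \<le> norm (b k) * norm x + norm x"
      by (intro add_mono mult_left_mono norm_functional_le) auto
    finally show ?thesis by (simp add: algebra_simps)
  qed
  have "norm (coord1 k x) \<le> norm (f (2 * k + 2) x) + real (ratio (Suc k)) * norm (b k * f 0 x - f 1 x)"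
    unfolding coord1_def by (rule order_trans[OF norm_triangle_ineq4]) (simp add: norm_mult)
  also have "\<dots> \<le> norm x + real (ratio (Suc k)) * ((1 + norm (b k)) * norm x)"
    using * by (intro add_mono mult_left_mono norm_functional_le) auto
  finally have "norm (coord1 k x) + norm (coord2 k x) \<le>
      2 * norm x + real (ratio (Suc k)) * ((1 + norm (b k)) * norm x)"
    using norm_functional_le[of "2 * k + 3" x] by (simp add: coord2_def)
  moreover have "1 * (1 * norm x) \<le> real (ratio (Suc k)) * ((1 + norm (b k)) * norm x)"
    using ratio_pos[of "Suc k"] by (intro mult_mono) auto
  ultimately show ?thesis by (simp add: mult.assoc)
qed

text \<open>Both shifts are at most the angle times the coordinates. The factor
  \<open>ratio (Suc k)\<close> from the far centre cancels against the one in
  \<open>period (Suc k)\<close>, the denominator of \<open>ang k\<close>.\<close>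

lemma norm_block_le: "norm (block n k x) \<le> 6 * pi * norm x * (real n * weight k / real (period k))"
proof -
  define t where "t = real n * ang k"
  define M where "M = norm (coord1 k x) + norm (coord2 k x)"
  have t: "0 \<le> t" by (simp add: t_def ang_def)
  have c: "norm (of_real (cos t - 1) * z) \<le> t * norm z" for z :: 'k
    using abs_cos_minus_one_le[of t] t unfolding norm_mult norm_of_real by (intro mult_right_mono) auto
  have s: "norm (of_real (sin t) * z) \<le> t * norm z" for z :: 'k
    using abs_sin_x_le_abs_x[of t] t unfolding norm_mult norm_of_real by (intro mult_right_mono) auto
  have "norm (shift1 n k x) \<le> t * M"
    unfolding shift1_def M_def distrib_left t_def[symmetric]
    by (rule order_trans[OF norm_triangle_ineq4 add_mono[OF c s]])
  moreover have "norm (shift2 n k x) \<le> t * M"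
    unfolding shift2_def M_def distrib_left t_def[symmetric]
    by (rule order_trans[OF norm_triangle_ineq add_mono[OF s c]])
  moreover have "norm (block n k x) \<le> norm (shift1 n k x) * norm (e (2 * k + 2)) + norm (shift2 n k x) * norm (e (2 * k + 3))"
    unfolding block_def by (rule order_trans[OF norm_triangle_ineq]) (simp add: norm_scale)
  ultimately have "norm (block n k x) \<le> t * M * norm (e (2 * k + 2)) + t * M * norm (e (2 * k + 3))"
    by (smt (verit) mult_right_mono norm_ge_zero)
  also have "\<dots> = t * (norm (e (2 * k + 2)) + norm (e (2 * k + 3))) * M"
    by (simp add: algebra_simps)
  also have "\<dots> \<le> t * (norm (e (2 * k + 2)) + norm (e (2 * k + 3))) *
      (3 * real (ratio (Suc k)) * (1 + norm (b k)) * norm x)"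
    unfolding M_def using t by (intro mult_left_mono norm_coord1_coord2_le) auto
  also have "\<dots> = 3 * t * real (ratio (Suc k)) * weight k * norm x"
    by (simp add: weight_def)
  also have "\<dots> = 6 * pi * norm x * (real n * weight k / real (period k))"
    using ratio_pos[of "Suc k"] period_pos[of k]
    by (simp add: t_def ang_def period_Suc field_simps)
  finally show ?thesis .
qed

lemma norm_block_le_geometric: "norm (block n k x) \<le> 6 * pi * norm x * (real n * (1 / 4) ^ k)"
proof (rule order_trans[OF norm_block_le])
  have "weight k \<le> (1 / 4) ^ k * real (period k)"
    by (rule order_trans[OF weight_le_ratio]) (use ratio_le_period[of k] in \<open>auto intro!: mult_left_mono\<close>)
  then have "weight k / real (period k) \<le> (1 / 4) ^ k"
    using period_pos[of k] by (simp add: field_simps)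
  then have "real n * (weight k / real (period k)) \<le> real n * (1 / 4) ^ k"
    by (intro mult_left_mono) auto
  then show "6 * pi * norm x * (real n * weight k / real (period k)) \<le> 6 * pi * norm x * (real n * (1 / 4) ^ k)"
    by (intro mult_left_mono) auto
qed

text \<open>At the time \<open>period j\<close> the factor \<open>real n\<close> of the general
  bound is absorbed too, which makes the bound uniform in \<open>j\<close>.\<close>

lemma norm_block_period_le:
  assumes "j < k"
  shows "norm (block (period j) k x) \<le> 6 * pi * norm x * (1 / 4) ^ k"
proof (rule order_trans[OF norm_block_le])
  have "real (period j) * weight k \<le> real (period j) * ((1 / 4) ^ k * real (ratio k))"
    by (intro mult_left_mono weight_le_ratio) auto
  also have "\<dots> = (1 / 4) ^ k * real (period j * ratio k)"
    by simp
  also have "\<dots> \<le> (1 / 4) ^ k * real (period k)"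
    using period_mult_ratio_le[OF assms] by (intro mult_left_mono of_nat_mono) auto
  finally have "real (period j) * weight k / real (period k) \<le> (1 / 4) ^ k"
    using period_pos[of k] by (simp add: field_simps)
  then show "6 * pi * norm x * (real (period j) * weight k / real (period k)) \<le> 6 * pi * norm x * (1 / 4) ^ k"
    by (intro mult_left_mono) auto
qed

lemma summable_geometric_bound: "summable (\<lambda>k. C * (D * (1 / 4) ^ k) :: real)"
  by (intro summable_mult summable_geometric) auto

lemma summable_block: "summable (\<lambda>k. block n k x)"
  by (rule summable_comparison_test'[OF summable_geometric_bound[of "6 * pi * norm x" "real n"]])
    (rule norm_block_le_geometric)

section \<open>Coordinates and iterates of the operator\<close>

lemma f_block:
  "f i (block n k x) = (if i = 2 * k + 2 then shift1 n k x else if i = 2 * k + 3 then shift2 n k x else 0)"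
  by (auto simp: block_def biorthogonal)

lemma f_T: "f i (T n x) = f i x + (\<Sum>k. f i (block n k x))"
  unfolding T_def f_add bounded_linear.suminf[OF bounded_linear_f summable_block] ..

lemma f_T_low: "i < 2 \<Longrightarrow> f i (T n x) = f i x"
  by (simp add: f_T f_block)

lemma f_T_fst: "f (2 * k + 2) (T n x) = f (2 * k + 2) x + shift1 n k x"
proof -
  have "f (2 * k + 2) (block n j x) = (if j = k then shift1 n j x else 0)" for j
  proof -
    have "2 * k + 2 \<noteq> 2 * j + 3" by presburger
    then show ?thesis unfolding f_block by auto
  qed
  then show ?thesis
    using sums_single[of k "\<lambda>j. shift1 n j x"] by (simp only: f_T sums_unique[symmetric])
qed

lemma f_T_snd: "f (2 * k + 3) (T n x) = f (2 * k + 3) x + shift2 n k x"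
proof -
  have "f (2 * k + 3) (block n j x) = (if j = k then shift2 n j x else 0)" for j
  proof -
    have "2 * k + 3 \<noteq> 2 * j + 2" by presburger
    then show ?thesis unfolding f_block by auto
  qed
  then show ?thesis
    using sums_single[of k "\<lambda>j. shift2 n j x"] by (simp only: f_T sums_unique[symmetric])
qed

lemma coord1_T: "coord1 k (T n x) = coord1 k x + shift1 n k x"
  using f_T_low[of 0 n x] f_T_low[of 1 n x] unfolding coord1_def f_T_fst by simp

lemma coord2_T: "coord2 k (T n x) = coord2 k x + shift2 n k x"
  unfolding coord2_def f_T_snd ..

text \<open>\<open>T n\<close> fixes \<open>f 0\<close> and \<open>f 1\<close>, hence the centre of
  each rotation; relative to it the angles add.\<close>

lemma block_add: "block (m + n) k x = block n k x + block m k (T n x)"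
proof -
  have "shift1 (m + n) k x = shift1 n k x + shift1 m k (T n x)"
    unfolding shift1_def[of m] shift1_def[of "m + n"] coord1_T coord2_T
    by (simp add: shift1_def shift2_def distrib_right cos_add sin_add algebra_simps)
  moreover have "shift2 (m + n) k x = shift2 n k x + shift2 m k (T n x)"
    unfolding shift2_def[of m] shift2_def[of "m + n"] coord1_T coord2_T
    by (simp add: shift1_def shift2_def distrib_right cos_add sin_add algebra_simps)
  ultimately show ?thesis
    by (simp add: block_def scale_left_distrib)
qed

lemma T_add: "T (m + n) x = T m (T n x)"
  unfolding T_def[of m] T_def[of "m + n"] block_add
  by (simp add: suminf_add[OF summable_block summable_block, symmetric] T_def[of n])

lemma T_funpow: "(T 1 ^^ n) x = T n x"
proof (induction n)
  case 0
  then show ?case by (simp add: T_def block_def shift1_def shift2_def)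
next
  case (Suc n)
  then show ?case using T_add[of 1 n x] by simp
qed

section \<open>Linearity and continuity\<close>

lemma block_linear:
  "block n k (x + y) = block n k x + block n k y"
  "block n k (smul a x) = smul a (block n k x)"
  by (simp_all add: block_def shift1_def shift2_def coord1_def coord2_def algebra_simps)

lemma T_plus: "T n (x + y) = T n x + T n y"
  by (simp add: T_def block_linear suminf_add[OF summable_block summable_block, symmetric])

lemma T_smul: "T n (smul a x) = smul a (T n x)"
proof -
  interpret smul: bounded_bilinear smul by (rule bounded_bilinear_smul)
  show ?thesis
    by (simp add: T_def block_linear scale_right_distrib
        bounded_linear.suminf[OF smul.bounded_linear_right summable_block])
qed

lemma linear_T: "Vector_Spaces.linear smul smul (T n)"
  unfolding linear_iff_module_hom
  by (simp add: module_hom_iff module_axioms T_plus T_smul)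

lemma continuous_on_T: "continuous_on UNIV (T n)"
proof -
  have "bounded_linear (T n)"
  proof (rule bounded_linear_intro[where K = "1 + 6 * pi * (real n * (\<Sum>k. (1 / 4) ^ k))"])
    show "T n (r *\<^sub>R x) = r *\<^sub>R T n x" for r x
      by (metis T_smul scale_of_real)
    show "norm (T n x) \<le> norm x * (1 + 6 * pi * (real n * (\<Sum>k. (1 / 4) ^ k)))" for x
    proof -
      have "norm (\<Sum>k. block n k x) \<le> (\<Sum>k. 6 * pi * norm x * (real n * (1 / 4) ^ k))"
        by (rule norm_suminf_le[OF norm_block_le_geometric summable_geometric_bound])
      also have "\<dots> = 6 * pi * norm x * (real n * (\<Sum>k. (1 / 4) ^ k))"
        by (simp add: suminf_mult summable_mult summable_geometric)
      finally show ?thesis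
        unfolding T_def by (intro order_trans[OF norm_triangle_ineq]) (simp add: algebra_simps)
    qed
  qed (rule T_plus)
  then show ?thesis
    by (rule linear_continuous_on)
qed

section \<open>Recurrent vectors\<close>

lemma norm_T_period_le:
  assumes "coord1 j x = 0" "coord2 j x = 0"
  shows "norm (T (period j) x - x) \<le> 12 * pi * norm x * (1 / 2) ^ j"
proof -
  have "norm (block (period j) k x) \<le> 6 * pi * norm x * (1 / 2) ^ j * (1 / 2) ^ k" for k
  \<comment> \<open>Planes before \<open>j\<close> have made whole turns, since
    \<open>period (Suc k)\<close> divides \<open>period j\<close>; plane \<open>j\<close> sits at
    its centre; later planes obey \<open>norm_block_period_le\<close>.\<close>
  proof (cases k j rule: linorder_cases)
    case less
    then obtain l where l: "period j = period (Suc k) * l"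
      using period_dvd[of "Suc k" j] by (auto elim: dvdE)
    have "real (period j) * ang k = real l * (2 * pi)"
      using period_pos[of "Suc k"] by (simp add: ang_def l field_simps)
    then have "cos (real (period j) * ang k) = 1" "sin (real (period j) * ang k) = 0"
      using cos_int_2pin[of "int l"] sin_int_2pin[of "int l"] by (simp_all add: mult.commute)
    then show ?thesis
      by (simp add: block_def shift1_def shift2_def)
  next
    case equal
    then show ?thesis
      using assms by (simp add: block_def shift1_def shift2_def)
  next
    case greater
    then have "norm (block (period j) k x) \<le> 6 * pi * norm x * (1 / 4) ^ k"
      by (rule norm_block_period_le)
    \<comment> \<open>One factor \<open>(1 / 2) ^ k\<close> is traded for decay in \<open>j\<close>,
      the other keeps the sum over \<open>k\<close> finite.\<close>
    also have "\<dots> = 6 * pi * norm x * ((1 / 2) ^ k * (1 / 2) ^ k)"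
      by (simp flip: power_mult_distrib)
    also have "\<dots> \<le> 6 * pi * norm x * ((1 / 2) ^ j * (1 / 2) ^ k)"
      using greater by (intro mult_left_mono mult_right_mono power_decreasing) auto
    finally show ?thesis by simp
  qed
  then have "norm (\<Sum>k. block (period j) k x) \<le> (\<Sum>k. 6 * pi * norm x * (1 / 2) ^ j * (1 / 2) ^ k)"
    by (rule norm_suminf_le) (intro summable_mult summable_geometric, simp)
  also have "\<dots> = 6 * pi * norm x * (1 / 2) ^ j * 2"
    by (subst suminf_mult) (simp_all add: suminf_geometric summable_geometric)
  finally show ?thesis by (simp add: T_def)
qed

text \<open>At the times \<open>period j\<close> with \<open>b j = d\<close> and \<open>j\<close>
  large, the centre of plane \<open>j\<close> is the origin and the coordinates of \<open>x\<close>
  there vanish, so \<open>norm_T_period_le\<close> applies.\<close>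

lemma recurrent_vector_T:
  assumes zero: "\<And>k. N \<le> k \<Longrightarrow> f k x = 0" and inf: "infinite {j. b j = d}"
    and d: "f 1 x = d * f 0 x"
  shows "recurrent_vector (T 1) x"
proof -
  \<comment> \<open>Dropping \<open>j < N\<close> puts \<open>2 * j + 2\<close> and
    \<open>2 * j + 3\<close> past \<open>N\<close>, where the functionals vanish on
    \<open>x\<close>.\<close>
  define J where "J = {j. b j = d} - {..<N}"
  have J: "infinite J" using inf by (simp add: J_def)
  define \<omega> where "\<omega> i = period (enumerate J i)" for i
  have "strict_mono \<omega>"
    using strict_mono_period strict_mono_enumerate[OF J] by (simp add: \<omega>_def strict_mono_def)
  moreover have "\<forall>i. 0 < \<omega> i"
    by (simp add: \<omega>_def period_pos)
  moreover have "(\<lambda>i. (T 1 ^^ \<omega> i) x) \<longlonglongrightarrow> x"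
  proof (rule LIM_zero_cancel, rule Lim_null_comparison)
    show "\<forall>\<^sub>F i in sequentially. norm ((T 1 ^^ \<omega> i) x - x) \<le> 12 * pi * norm x * (1 / 2) ^ i"
    proof (intro always_eventually allI)
      fix i
      define j where "j = enumerate J i"
      have j: "b j = d" "N \<le> j" "i \<le> j"
        using enumerate_in_set[OF J, of i] le_enumerate[OF J, of i] by (auto simp: j_def J_def)
      have "norm ((T 1 ^^ \<omega> i) x - x) \<le> 12 * pi * norm x * (1 / 2) ^ j"
        unfolding T_funpow \<omega>_def j_def[symmetric]
        by (rule norm_T_period_le) (use j d zero in \<open>auto simp: coord1_def coord2_def\<close>)
      also have "\<dots> \<le> 12 * pi * norm x * (1 / 2) ^ i"
        using j by (intro mult_left_mono power_decreasing) auto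
      finally show "norm ((T 1 ^^ \<omega> i) x - x) \<le> 12 * pi * norm x * (1 / 2) ^ i" .
    qed
    show "(\<lambda>i. 12 * pi * norm x * (1 / 2) ^ i) \<longlonglongrightarrow> 0"
      by (intro tendsto_mult_right_zero LIMSEQ_power_zero) simp
  qed
  ultimately show ?thesis
    unfolding recurrent_vector_def by blast
qed

section \<open>Vectors that are not recurrent\<close>

text \<open>
  The rotation minus the identity is a similarity of factor \<open>2 * sin (n * ang k / 2)\<close>; applying its
  transpose recovers \<open>coord1\<close> from the two coordinates of \<open>T n x - x\<close>.
\<close>

lemma norm_T_diff_ge: "\<bar>sin (real n * ang k / 2)\<bar> * norm (coord1 k x) \<le> norm (T n x - x)"
proof -
  define t where "t = real n * ang k"
  define s where "s = \<bar>sin (t / 2)\<bar>"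
  let ?U = "shift1 n k x" and ?V = "shift2 n k x"
  have s: "0 \<le> s" "s \<le> 1" by (simp_all add: s_def)
  have cos: "cos t - 1 = - 2 * s ^ 2"
    using cos_double_sin[of "t / 2"] by (simp add: s_def)
  have "\<bar>sin t\<bar> = 2 * (s * \<bar>cos (t / 2)\<bar>)"
    using sin_double[of "t / 2"] by (simp add: s_def abs_mult)
  also have "\<dots> \<le> 2 * (s * 1)"
    using s by (intro mult_left_mono) auto
  finally have sin: "\<bar>sin t\<bar> \<le> 2 * s" by simp
  have "(cos t - 1)\<^sup>2 + (sin t)\<^sup>2 = 2 - 2 * cos t"
    using sin_cos_squared_add[of t] by (simp add: power2_eq_square algebra_simps)
  also have "\<dots> = 4 * s\<^sup>2" using cos by simp
  finally have sq: "(cos t - 1)\<^sup>2 + (sin t)\<^sup>2 = 4 * s\<^sup>2" .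
  have "of_real (cos t - 1) * ?U + of_real (sin t) * ?V =
      of_real ((cos t - 1)\<^sup>2 + (sin t)\<^sup>2) * coord1 k x"
    unfolding shift1_def shift2_def t_def[symmetric] of_real_add of_real_power by algebra
  then have "4 * s\<^sup>2 * norm (coord1 k x) = norm (of_real (cos t - 1) * ?U + of_real (sin t) * ?V)"
    unfolding sq norm_mult by (simp add: norm_mult norm_power)
  also have "\<dots> \<le> \<bar>cos t - 1\<bar> * norm ?U + \<bar>sin t\<bar> * norm ?V"
    by (rule order_trans[OF norm_triangle_ineq]) (simp only: norm_mult norm_of_real order_refl)
  also have "\<dots> \<le> 2 * s * norm ?U + 2 * s * norm ?V"
  proof (intro add_mono mult_right_mono)
    show "\<bar>cos t - 1\<bar> \<le> 2 * s"
      using s mult_left_le[of s s] by (simp add: cos power2_eq_square)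
  qed (use sin in auto)
  also have "\<dots> \<le> 2 * s * norm (T n x - x) + 2 * s * norm (T n x - x)"
  proof (intro add_mono mult_left_mono)
    show "norm ?U \<le> norm (T n x - x)"
      using norm_functional_le[of "2 * k + 2" "T n x - x"] unfolding f_diff f_T_fst by simp
    show "norm ?V \<le> norm (T n x - x)"
      using norm_functional_le[of "2 * k + 3" "T n x - x"] unfolding f_diff f_T_snd by simp
  qed (use s in auto)
  finally have "(4 * s) * (s * norm (coord1 k x)) \<le> (4 * s) * norm (T n x - x)"
    by (simp add: power2_eq_square)
  then show ?thesis
    using s by (cases "s = 0") (auto simp: s_def[unfolded t_def] simp flip: t_def)
qed

text \<open>With \<open>f 0 x = 0\<close> the centre of plane \<open>k\<close> is at
  \<open>- ratio (Suc k) * f 1 x\<close>. The radius is thus of the order of the ratio, while the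
  sine of half the angle is at least half its inverse at the times in question, so the displacement
  stays bounded below.\<close>

lemma not_recurrent_vector_T:
  assumes "f 0 x = 0" "f 1 x \<noteq> 0"
  shows "\<not> recurrent_vector (T 1) x"
proof
  assume "recurrent_vector (T 1) x"
  then obtain \<omega> where \<omega>: "strict_mono \<omega>" "(\<lambda>n. (T 1 ^^ \<omega> n) x) \<longlonglongrightarrow> x"
    unfolding recurrent_vector_def by blast
  define z where "z = norm (f 1 x)"
  have z: "0 < z" using assms by (simp add: z_def)
  \<comment> \<open>From scale \<open>K\<close> on, \<open>ratio (Suc k) * z\<close> is at least
    \<open>2 * norm x\<close>, so the coordinates of \<open>x\<close> cannot offset the far
    centre.\<close>
  obtain K where K: "2 * norm x / z < 4 ^ K"
    using real_arch_pow[of 4 "2 * norm x / z"] by auto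
  have lower: "z / 4 \<le> norm (T n x - x)" if n: "period K \<le> n" for n
  proof -
    define l where "l = (LEAST l. 2 * n < period l)"
    \<comment> \<open>The scale \<open>k\<close> with \<open>period k \<le> 2 * n < period (Suc k)\<close> is the one that detects the time \<open>n\<close>.\<close>
    have "\<exists>l. 2 * n < period l"
      using strict_mono_imp_increasing[OF strict_mono_period, of "Suc (2 * n)"] by (meson Suc_le_lessD)
    then have l: "2 * n < period l" and least: "\<And>i. i < l \<Longrightarrow> \<not> 2 * n < period i"
      unfolding l_def by (auto intro: LeastI_ex dest: not_less_Least)
    have "K < l"
      using l n strict_mono_less[OF strict_mono_period, of K l] by linarith
    then obtain k where k: "l = Suc k" "K \<le> k"
      by (metis less_Suc_eq_le less_imp_Suc_add le_add1)
    define r where "r = real (ratio (Suc k))"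
    have "period k \<le> 2 * n"
      using least[of k] k by simp
    have "4 ^ K \<le> (4::real) ^ Suc k"
      using k by (intro power_increasing) auto
    then have "2 * norm x / z \<le> r"
      using K ratio_ge_power[of "Suc k"] unfolding r_def by linarith
    then have r: "2 * norm x \<le> r * z"
      using z by (simp add: field_simps)
    have r0: "0 < r" using ratio_pos by (simp add: r_def)
    have per: "real (period (Suc k)) = real (period k) * r"
      by (simp add: period_Suc r_def)
    have pk: "0 < real (period k)" using period_pos by simp
    \<comment> \<open>Half the angle is at most \<open>pi / 2\<close> because
      \<open>2 * n < period (Suc k)\<close>; \<open>period k \<le> 2 * n\<close> bounds it from
      below, and \<open>pi > 3\<close> makes up for the third in
      \<open>sin_ge_third\<close>.\<close>
    have "real n * ang k / 2 = pi * (real n / real (period (Suc k)))"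
      by (simp add: ang_def)
    moreover have "real n / real (period (Suc k)) \<le> 1 / 2"
      using l k period_pos[of "Suc k"] by (simp add: field_simps)
    then have "pi * (real n / real (period (Suc k))) \<le> pi * (1 / 2)"
      by (intro mult_left_mono) auto
    ultimately have "pi * (real n / real (period (Suc k))) / 3 \<le> sin (real n * ang k / 2)"
      using sin_ge_third[of "real n * ang k / 2"] by simp
    moreover have "1 * (real n / real (period (Suc k))) \<le> pi / 3 * (real n / real (period (Suc k)))"
      using pi_gt3 by (intro mult_right_mono) auto
    moreover have "1 / (2 * r) \<le> real n / real (period (Suc k))"
      using \<open>period k \<le> 2 * n\<close> r0 pk unfolding per by (simp add: field_simps)
    ultimately have sin: "1 / (2 * r) \<le> \<bar>sin (real n * ang k / 2)\<bar>"
      by simp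
    have "r * z = norm (of_nat (ratio (Suc k)) * f 1 x)"
      by (simp add: r_def z_def norm_mult)
    also have "\<dots> = norm (coord1 k x - f (2 * k + 2) x)"
      using assms by (simp add: coord1_def)
    also have "\<dots> \<le> norm (coord1 k x) + norm x"
      by (rule order_trans[OF norm_triangle_ineq4]) (simp add: norm_functional_le)
    finally have "r * z / 2 \<le> norm (coord1 k x)"
      using r by simp
    \<comment> \<open>The factors \<open>r\<close> cancel and leave \<open>z / 4\<close>.\<close>
    then have "1 / (2 * r) * (r * z / 2) \<le> \<bar>sin (real n * ang k / 2)\<bar> * norm (coord1 k x)"
      using sin r0 z by (intro mult_mono) auto
    with norm_T_diff_ge[of n k x] r0 show ?thesis
      by (simp add: field_simps)
  qed
  have "\<forall>\<^sub>F n in sequentially. dist ((T 1 ^^ \<omega> n) x) x < z / 4"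
    using \<omega>(2) z by (intro tendstoD) auto
  then obtain N where N: "\<And>n. N \<le> n \<Longrightarrow> norm (T (\<omega> n) x - x) < z / 4"
    unfolding eventually_sequentially T_funpow dist_norm by blast
  \<comment> \<open>Past \<open>N\<close> the orbit is within \<open>z / 4\<close> of
    \<open>x\<close>, but \<open>period K \<le> \<omega> n\<close> keeps it at least that far
    away.\<close>
  define n where "n = max N (period K)"
  have "period K \<le> \<omega> n"
    using strict_mono_imp_increasing[OF \<omega>(1), of n] by (simp add: n_def)
  then show False
    using lower[of "\<omega> n"] N[of n] by (simp add: n_def)
qed

text \<open>A dense subspace has vectors near \<open>e 0\<close> and near \<open>e 1\<close>;
  eliminating \<open>f 0\<close> between them leaves a vector with \<open>f 1\<close> nonzero, which
  \<open>not_recurrent_vector_T\<close> excludes.\<close>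

lemma not_dense_lineable_Rec_T: "\<not> dense_lineable smul (Rec (T 1))"
proof
  assume "dense_lineable smul (Rec (T 1))"
  then obtain V where V: "module.subspace smul V" "closure V = UNIV" "V \<subseteq> Rec (T 1) \<union> {0}"
    unfolding dense_lineable_def by auto
  have approx: "\<exists>v\<in>V. norm (v - y) < 1 / 4" for y
  proof -
    have "y \<in> closure V" using V(2) by simp
    then have "\<exists>v\<in>V. dist v y < 1 / 4"
      by (rule closure_approachable[THEN iffD1, rule_format]) simp
    then show ?thesis by (simp only: dist_norm)
  qed
  obtain v w where v: "v \<in> V" "norm (v - e 0) < 1 / 4" and w: "w \<in> V" "norm (w - e 1) < 1 / 4"
    using approx by metis
  have v': "norm (f i v - f i (e 0)) < 1 / 4" for i
    using norm_functional_le[of i "v - e 0"] v by simp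
  have w': "norm (f i w - f i (e 1)) < 1 / 4" for i
    using norm_functional_le[of i "w - e 1"] w by simp
  \<comment> \<open>\<open>f 1 x\<close> is the determinant of \<open>(f 0, f 1)\<close> on \<open>(v, w)\<close>, which is close to \<open>1\<close>.\<close>
  define x where "x = smul (f 0 v) w - smul (f 0 w) v"
  have x: "x \<in> V"
    using V(1) v w unfolding x_def by (intro subspace_diff subspace_scale)
  have f0: "f 0 x = 0" by (simp add: x_def mult.commute)
  have "f 1 x \<noteq> 0"
  proof
    assume "f 1 x = 0"
    then have eq: "f 0 v * f 1 w = f 0 w * f 1 v"
      by (simp add: x_def)
    have a: "norm (f 0 v - 1) < 1 / 4" "norm (f 1 w - 1) < 1 / 4" "norm (f 1 v) < 1 / 4" "norm (f 0 w) < 1 / 4"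
      using v'[of 0] v'[of 1] w'[of 0] w'[of 1] by (simp_all add: biorthogonal)
    \<comment> \<open>One product has norm at most 1/16, the other at least 9/16, so they
      differ.\<close>
    have "norm (f 0 w * f 1 v) \<le> 1 / 4 * (1 / 4)"
      unfolding norm_mult using a by (intro mult_mono) auto
    moreover have "3 / 4 \<le> norm (f 0 v)" "3 / 4 \<le> norm (f 1 w)"
      using a norm_triangle_ineq2[of 1 "f 0 v"] norm_triangle_ineq2[of 1 "f 1 w"]
      by (simp_all add: norm_minus_commute)
    then have "3 / 4 * (3 / 4) \<le> norm (f 0 v * f 1 w)"
      unfolding norm_mult by (intro mult_mono) auto
    ultimately show False using eq by simp
  qed
  moreover from this have "x \<noteq> 0"
    using f_diff[of 1 0 0] by auto
  ultimately show False
    using V(3) x f0 not_recurrent_vector_T[of x] by (auto simp: Rec_def)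
qed

section \<open>Density of the recurrent vectors\<close>

lemma recurrent_T:
  assumes dense: "closure (range y) = UNIV" and fin: "\<And>n k. n < k \<Longrightarrow> f k (y n) = 0"
    and b: "\<And>a \<epsilon>. 0 < \<epsilon> \<Longrightarrow> \<exists>d. norm (d - a) < \<epsilon> \<and> infinite {j. b j = d}"
  shows "recurrent (T 1)"
proof -
  have "range y \<subseteq> closure (Rec (T 1))"
  proof safe
    fix n
    show "y n \<in> closure (Rec (T 1))"
      unfolding closure_approachable
    proof (intro allI impI)
      fix \<epsilon> :: real assume "0 < \<epsilon>"
      \<comment> \<open>Both corrections to \<open>y n\<close> have coefficients of norm at most
        \<delta>, which keeps their sum below \<epsilon>.\<close>
      define \<delta> where "\<delta> = \<epsilon> / (1 + norm (e 0) + norm (e 1))"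
      have pos: "0 < 1 + norm (e 0) + norm (e 1)"
        by (simp add: add_pos_nonneg)
      have \<delta>: "0 < \<delta>" using \<open>0 < \<epsilon>\<close> pos by (simp add: \<delta>_def)
      \<comment> \<open>\<eta> moves \<open>f 0\<close> off zero, so that one can divide by
        \<open>a\<close>.\<close>
      define \<eta> :: 'k where "\<eta> = (if f 0 (y n) = 0 then of_real \<delta> else 0)"
      define a where "a = f 0 (y n) + \<eta>"
      have a: "a \<noteq> 0" "norm \<eta> \<le> \<delta>"
        using \<delta> by (auto simp: a_def \<eta>_def)
      \<comment> \<open>The tolerance is divided by \<open>norm a\<close> because the error in
        \<open>d\<close> gets multiplied by \<open>a\<close>.\<close>
      obtain d where d: "norm (d - f 1 (y n) / a) < \<delta> / norm a" "infinite {j. b j = d}"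
        using b[of "\<delta> / norm a" "f 1 (y n) / a"] \<delta> a by auto
      have "norm (d * a - f 1 (y n)) = norm (d - f 1 (y n) / a) * norm a"
        unfolding norm_mult[symmetric] using a by (simp add: left_diff_distrib)
      then have d': "norm (d * a - f 1 (y n)) \<le> \<delta>"
        using d(1) a by (simp add: field_simps)
      define x where "x = y n + smul \<eta> (e 0) + smul (d * a - f 1 (y n)) (e 1)"
      have "recurrent_vector (T 1) x"
      proof (rule recurrent_vector_T)
        \<comment> \<open>\<open>f k\<close> kills \<open>y n\<close> for \<open>n < k\<close>, and
          both \<open>e 0\<close> and \<open>e 1\<close> for \<open>2 \<le> k\<close>.\<close>
        show "f k x = 0" if "n + 2 \<le> k" for k
          using that fin[of n k] by (simp add: x_def biorthogonal)
        show "f 1 x = d * f 0 x"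
          by (simp add: x_def biorthogonal a_def)
      qed (rule d(2))
      moreover have "dist x (y n) < \<epsilon>"
      proof -
        have "dist x (y n) = norm (smul \<eta> (e 0) + smul (d * a - f 1 (y n)) (e 1))"
          by (simp add: dist_norm x_def)
        also have "\<dots> \<le> norm \<eta> * norm (e 0) + norm (d * a - f 1 (y n)) * norm (e 1)"
          by (rule order_trans[OF norm_triangle_ineq]) (simp add: norm_scale)
        also have "\<dots> \<le> \<delta> * norm (e 0) + \<delta> * norm (e 1)"
          using a d' by (intro add_mono mult_right_mono) auto
        also have "\<dots> < \<delta> * (1 + norm (e 0) + norm (e 1))"
          using \<delta> by (simp add: algebra_simps)
        also have "\<dots> = \<epsilon>" using pos by (simp add: \<delta>_def)
        finally show ?thesis .
      qed
      ultimately show "\<exists>x\<in>Rec (T 1). dist x (y n) < \<epsilon>"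
        by (auto simp: Rec_def)
    qed
  qed
  then have "closure (range y) \<subseteq> closure (Rec (T 1))"
    by (simp add: closure_minimal)
  with dense show ?thesis
    by (auto simp: recurrent_def)
qed

end

section \<open>Assembly over the real and complex scalars\<close>

lemma exists_dense_recurring_sequence:
  "\<exists>b :: nat \<Rightarrow> 'k::{second_countable_topology, real_normed_vector}.
    \<forall>a. \<forall>\<epsilon>>0. \<exists>d. norm (d - a) < \<epsilon> \<and> infinite {j. b j = d}"
proof -
  obtain D :: "'k set" where D: "countable D" "\<And>X. open X \<Longrightarrow> X \<noteq> {} \<Longrightarrow> \<exists>d\<in>D. d \<in> X"
    using countable_dense_setE by blast
  \<comment> \<open>The first component of the pair picks an element of \<open>D\<close>, the second
    repeats it infinitely often.\<close>
  define b where "b j = from_nat_into D (fst (prod_decode j))" for j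
  have "\<exists>d. norm (d - a) < \<epsilon> \<and> infinite {j. b j = d}" if \<epsilon>: "0 < \<epsilon>" for a \<epsilon>
  proof -
    obtain d where d: "d \<in> D" "d \<in> ball a \<epsilon>"
      using D(2)[of "ball a \<epsilon>"] \<epsilon> by auto
    obtain i where i: "from_nat_into D i = d"
      using from_nat_into_surj[OF D(1) d(1)] by blast
    have "inj (\<lambda>l. prod_encode (i, l))"
      by (auto intro!: injI)
    then have "infinite (range (\<lambda>l. prod_encode (i, l)))"
      by (rule range_inj_infinite)
    moreover have "range (\<lambda>l. prod_encode (i, l)) \<subseteq> {j. b j = d}"
      by (auto simp: b_def i)
    ultimately have "infinite {j. b j = d}"
      by (metis infinite_super)
    then show ?thesis
      using d(2) by (intro exI[of _ d]) (simp add: dist_norm norm_minus_commute)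
  qed
  then show ?thesis by blast
qed

text \<open>Uniform in the scalar field; the real and complex cases differ only in how the
  separating functionals are obtained.\<close>

lemma exists_recurrent_not_dense_lineable:
  fixes smul :: "'k::{real_normed_field, second_countable_topology} \<Rightarrow> 'a::banach \<Rightarrow> 'a"
  assumes sep: "separable_space (euclidean :: 'a topology)"
    and "normed_space_over smul" and inf: "infinite_dimensional smul"
    and separated: "\<And>v. v \<noteq> 0 \<Longrightarrow>
      \<exists>h :: 'a \<Rightarrow> 'k. bounded_linear h \<and> (\<forall>a x. h (smul a x) = a * h x) \<and> h v \<noteq> 0"
  shows "\<exists>T. Vector_Spaces.linear smul smul T \<and> continuous_on UNIV T \<and>
    recurrent T \<and> \<not> dense_lineable smul (Rec T)"
proof -
  interpret normed_space_over smul by fact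
  obtain C :: "'a set" where C: "countable C" "closure C = UNIV"
    using sep unfolding separable_space_def by auto
  then have "C \<noteq> {}" by auto
  define y where "y = from_nat_into C"
  have y: "closure (range y) = UNIV"
    using C \<open>C \<noteq> {}\<close> by (simp add: y_def range_from_nat_into)
  have functionals: "\<exists>h. bounded_functional h \<and> h v \<noteq> 0" if "v \<noteq> 0" for v
    using separated[OF that] by (simp add: bounded_functional_def conj_assoc)
  obtain e f where ef: "\<forall>n. bounded_functional (f n)" "\<forall>n z. norm (f n z) \<le> norm z"
    "\<forall>i j. f i (e j) = (if i = j then 1 else 0)" and fin: "\<forall>n k. n < k \<longrightarrow> f k (y n) = 0"
    using exists_biorthogonal_sequence[OF inf functionals, of y] by blast
  obtain b :: "nat \<Rightarrow> 'k" where b: "\<forall>a. \<forall>\<epsilon>>0. \<exists>d. norm (d - a) < \<epsilon> \<and> infinite {j. b j = d}"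
    using exists_dense_recurring_sequence by blast
  interpret biorthogonal_sequence smul e f b
    by unfold_locales (rule ef[rule_format])+
  have "recurrent (T 1)"
    by (rule recurrent_T[OF y]) (simp_all add: fin b)
  then show ?thesis
    using linear_T[of 1] continuous_on_T[of 1] not_dense_lineable_Rec_T by (intro exI[of _ "T 1"] conjI)
qed

text \<open>The usual complexification: a real functional \<open>u\<close> becomes the real part of
  \<open>h\<close>, and \<open>h (scaleC \<i> x) = \<i> * h x\<close> forces the imaginary
  part.\<close>

lemma exists_complex_bounded_functional_nonzero:
  fixes scaleC :: "complex \<Rightarrow> 'a::real_normed_vector \<Rightarrow> 'a"
  assumes "normed_space_over scaleC" and "v \<noteq> 0"
  shows "\<exists>h. bounded_linear h \<and> (\<forall>a x. h (scaleC a x) = a * h x) \<and> h v \<noteq> 0"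
proof -
  interpret normed_space_over scaleC by fact
  interpret smul: bounded_bilinear scaleC by (rule bounded_bilinear_smul)
  obtain u :: "'a \<Rightarrow> real" where u: "bounded_linear u" "u v \<noteq> 0"
    using exists_bounded_linear_nonzero[OF \<open>v \<noteq> 0\<close>] by blast
  define h where "h x = complex_of_real (u x) - \<i> * complex_of_real (u (scaleC \<i> x))" for x
  have "bounded_linear h"
    unfolding h_def
    by (intro bounded_linear_sub bounded_linear_compose[OF bounded_linear_of_real]
        bounded_linear_compose[OF bounded_linear_mult_right] u(1)
        bounded_linear_compose[OF u(1)] smul.bounded_linear_right)
  moreover have "h (scaleC a x) = a * h x" for a x
  proof -
    have lin: "linear u" using u by (simp add: bounded_linear.linear)
    have a: "scaleC a z = Re a *\<^sub>R z + Im a *\<^sub>R scaleC \<i> z" for z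
    proof -
      have "scaleC a z = scaleC (of_real (Re a) + of_real (Im a) * \<i>) z"
        by (simp add: complex_eq mult.commute)
      then show ?thesis
        by (simp only: scale_left_distrib scale_scale[symmetric] scale_of_real)
    qed
    have "u (scaleC a x) = Re a * u x + Im a * u (scaleC \<i> x)"
      by (simp add: a linear_add[OF lin] linear_scale[OF lin])
    moreover have "scaleC \<i> (scaleC a x) = scaleC a (scaleC \<i> x)"
      by (simp add: mult.commute)
    then have "u (scaleC \<i> (scaleC a x)) = Re a * u (scaleC \<i> x) - Im a * u x"
      by (simp add: a[of "scaleC \<i> x"] linear_diff[OF lin] linear_scale[OF lin] del: scale_scale)
        (simp add: linear_diff[OF lin] linear_neg[OF lin] linear_scale[OF lin])
    ultimately show ?thesis
      unfolding h_def by (simp only:) (simp add: complex_eq_iff algebra_simps)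
  qed
  moreover have "h v \<noteq> 0"
    using u(2) by (auto simp: h_def complex_eq_iff)
  ultimately show ?thesis by blast
qed

theorem theorem4p1:
  assumes "separable_space (euclidean :: 'a::banach topology)"
  shows "(infinite_dimensional ((*\<^sub>R) :: real \<Rightarrow> 'a \<Rightarrow> 'a) \<longrightarrow>
           (\<exists>T :: 'a \<Rightarrow> 'a. linear T \<and> continuous_on UNIV T \<and>
              recurrent T \<and> \<not> dense_lineable (*\<^sub>R) (Rec T))) \<and>
         (\<forall>scaleC :: complex \<Rightarrow> 'a \<Rightarrow> 'a.
           normed_space_over scaleC \<and> infinite_dimensional scaleC \<longrightarrow>
           (\<exists>T :: 'a \<Rightarrow> 'a. Vector_Spaces.linear scaleC scaleC T \<and> continuous_on UNIV T \<and>
              recurrent T \<and> \<not> dense_lineable scaleC (Rec T)))"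
proof (intro conjI impI allI)
  assume inf: "infinite_dimensional ((*\<^sub>R) :: real \<Rightarrow> 'a \<Rightarrow> 'a)"
  have functionals: "\<exists>h :: 'a \<Rightarrow> real. bounded_linear h \<and> (\<forall>a x. h (a *\<^sub>R x) = a * h x) \<and> h v \<noteq> 0"
    if v: "v \<noteq> 0" for v
  proof -
    obtain u :: "'a \<Rightarrow> real" where "bounded_linear u" "u v \<noteq> 0"
      using exists_bounded_linear_nonzero[OF v] by blast
    then show ?thesis
      by (auto simp: linear_scale bounded_linear.linear)
  qed
  show "\<exists>T :: 'a \<Rightarrow> 'a. linear T \<and> continuous_on UNIV T \<and>
      recurrent T \<and> \<not> dense_lineable (*\<^sub>R) (Rec T)"
    using exists_recurrent_not_dense_lineable[OF assms normed_space_over_scaleR inf functionals]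
    unfolding linear_def .
next
  fix scaleC :: "complex \<Rightarrow> 'a \<Rightarrow> 'a"
  assume scaleC: "normed_space_over scaleC \<and> infinite_dimensional scaleC"
  show "\<exists>T. Vector_Spaces.linear scaleC scaleC T \<and> continuous_on UNIV T \<and>
      recurrent T \<and> \<not> dense_lineable scaleC (Rec T)"
    using scaleC
    by (intro exists_recurrent_not_dense_lineable[OF assms] exists_complex_bounded_functional_nonzero) auto
qed

end
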